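(* Let $\Gamma\le S_m$ and let $a_1,\dots,a_m\ge2$ be integers. Let $O_1,\dots,O_k$ be the orbits of the action of the commutator subgroup $[\Gamma,\Gamma]$ on $[m]$, and for each $i$ let $n_i=\min\{a_j:j\in O_i\}$. Let $\Gamma'\le S_k$ be the permutation group on $\{1,\dots,k\}$ induced by the action of $\Gamma/[\Gamma,\Gamma]$ on the set of orbits ($\sigma\in\Gamma$ induces $i\mapsto i'$ where $\sigma(O_i)=O_{i'}$). Let $P_1,\dots,P_q$ be the orbits of $\Gamma'$ on $\{1,\dots,k\}$, with $P_j=\{c_{1,j},c_{2,j},\dots,c_{|P_j|,j}\}$, and let \[m_j=R_{\Gamma'|_{P_j}}(n_{c_{1,j}},n_{c_{2,j}},\dots,n_{c_{|P_j|,j}}),\] where $\Gamma'|_{P_j}$ is the group of permutations of $P_j$ obtained by restricting elements of $\Gamma'$ to $P_j$. Then \[R_\Gamma(a_1,a_2,\dots,a_m)\le R(m_1,m_2,\dots,m_q).\]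
   Context: An $m$-edge-coloured complete graph is a complete graph with each edge coloured from $[m]=\{1,\dots,m\}$. For a permutation group $\Delta$ on a finite colour set $C$, $\pi\in\Delta$ and a vertex $v$, switching at $v$ with $\pi$ recolours every edge incident with $v$ of colour $i$ to colour $\pi(i)$, leaving other edges unchanged. Two edge-coloured complete graphs on the same vertex set are $\Delta$-switch equivalent if one is obtained from the other by a finite sequence of switches. For colours $c_1,\dots,c_r$ forming $C$ and integers $b_1,\dots,b_r\ge2$, $R_\Delta(b_1,\dots,b_r)$ is the least $n$ such that every $C$-edge-coloured complete graph on $n$ vertices is $\Delta$-switch equivalent to one containing, for some $\ell$, a complete subgraph on $b_\ell$ vertices all of whose edges have colour $c_\ell$. $R(\cdot)$ is the classical multicolour Ramsey number. *)

theory Defs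
  imports
    "HOL-Algebra.Sym_Groups"
    "HOL-Algebra.Group_Action"
    "HOL-Combinatorics.Orbits"
    "HOL-Library.Ramsey"
begin

text \<open>
  The edges of the complete graph on \<open>V\<close> are the members of \<^term>\<open>[V]\<^bsup>2\<^esup>\<close>, so a
  \<open>C\<close>-edge-coloured complete graph on \<open>V\<close> is an element of \<^term>\<open>[V]\<^bsup>2\<^esup> \<rightarrow>\<^sub>E C\<close>. The
  extensional function space makes equality of such functions equality of colourings.
\<close>

definition switch :: "'v set \<Rightarrow> 'v \<Rightarrow> ('c \<Rightarrow> 'c) \<Rightarrow> ('v set \<Rightarrow> 'c) \<Rightarrow> ('v set \<Rightarrow> 'c)" where
  "switch V v \<pi> f = (\<lambda>e\<in>[V]\<^bsup>2\<^esup>. if v \<in> e then \<pi> (f e) else f e)"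

definition switch_step ::
    "('c \<Rightarrow> 'c) set \<Rightarrow> 'v set \<Rightarrow> ('v set \<Rightarrow> 'c) \<Rightarrow> ('v set \<Rightarrow> 'c) \<Rightarrow> bool" where
  "switch_step \<Delta> V f g \<longleftrightarrow> (\<exists>v\<in>V. \<exists>\<pi>\<in>\<Delta>. g = switch V v \<pi> f)"

definition switch_equivalent ::
    "('c \<Rightarrow> 'c) set \<Rightarrow> 'v set \<Rightarrow> ('v set \<Rightarrow> 'c) \<Rightarrow> ('v set \<Rightarrow> 'c) \<Rightarrow> bool" where
  "switch_equivalent \<Delta> V = (switch_step \<Delta> V)\<^sup>*\<^sup>*"

text \<open>
  \<open>switch_arrows \<Delta> C b n\<close>: every \<open>C\<close>-edge-coloured complete graph on \<open>n\<close> vertices is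
  \<open>\<Delta>\<close>-switch equivalent to one with a complete subgraph on \<open>b c\<close> vertices all of whose
  edges have colour \<open>c\<close>, for some \<open>c \<in> C\<close>. The sizes are indexed by the colours
  themselves, so no enumeration of \<open>C\<close> has to be chosen.
\<close>

definition switch_arrows :: "('c \<Rightarrow> 'c) set \<Rightarrow> 'c set \<Rightarrow> ('c \<Rightarrow> nat) \<Rightarrow> nat \<Rightarrow> bool" where
  "switch_arrows \<Delta> C b n \<longleftrightarrow>
     (\<forall>V :: nat set. finite V \<and> card V = n \<longrightarrow>
        (\<forall>f \<in> [V]\<^bsup>2\<^esup> \<rightarrow>\<^sub>E C.
           \<exists>g. switch_equivalent \<Delta> V f g \<and> (\<exists>c\<in>C. monochromatic V (b c) 2 g c)))"

definition switch_ramsey :: "('c \<Rightarrow> 'c) set \<Rightarrow> 'c set \<Rightarrow> ('c \<Rightarrow> nat) \<Rightarrow> nat" where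
  "switch_ramsey \<Delta> C b = (LEAST n. switch_arrows \<Delta> C b n)"

definition ramsey_number :: "nat list \<Rightarrow> nat" where
  "ramsey_number bs = (LEAST n. partn_lst {..<n} bs 2)"

text \<open>Both minima are over nonempty sets.\<close>

lemma switch_ramsey_attained:
  assumes "finite C"
  shows "switch_arrows \<Delta> C b (switch_ramsey \<Delta> C b)"
proof -
  obtain cs where cs: "set cs = C"
    using assms finite_list by blast
  obtain N :: nat where N: "partn_lst {..<N} (map b cs) 2"
    using ramsey_full by blast
  have "switch_arrows \<Delta> C b N"
    unfolding switch_arrows_def
  proof (intro allI impI ballI)
    fix V :: "nat set" and f
    assume V: "finite V \<and> card V = N" and f: "f \<in> [V]\<^bsup>2\<^esup> \<rightarrow>\<^sub>E C"
    then obtain h where h: "bij_betw h {..<N} V"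
      by (metis card_lessThan finite_lessThan finite_same_card_bij)
    define ix where "ix c = (SOME i. i < length cs \<and> cs ! i = c)" for c
    have ix: "ix c < length cs \<and> cs ! ix c = c" if "c \<in> C" for c
    proof -
      have "\<exists>i. i < length cs \<and> cs ! i = c"
        using that cs by (auto simp: in_set_conv_nth)
      then show ?thesis
        unfolding ix_def by (rule someI_ex)
    qed
    have sub: "h ` e \<in> [V]\<^bsup>k\<^esup>" if "e \<in> [{..<N}]\<^bsup>k\<^esup>" for e k
      using bij_betw_nsets[OF h] that by (auto simp: bij_betw_def)
    have "(\<lambda>e. ix (f (h ` e))) \<in> [{..<N}]\<^bsup>2\<^esup> \<rightarrow> {..<length (map b cs)}"
      using sub f ix by (auto simp: PiE_iff)
    then obtain i H where i: "i < length cs" and H: "H \<in> [{..<N}]\<^bsup>(map b cs ! i)\<^esup>"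
      and mono: "(\<lambda>e. ix (f (h ` e))) ` [H]\<^bsup>2\<^esup> \<subseteq> {i}"
      using N unfolding partn_lst_def monochromatic_def length_map by blast
    have "f e' = cs ! i" if e': "e' \<in> [h ` H]\<^bsup>2\<^esup>" for e'
    proof -
      have HN: "H \<subseteq> {..<N}"
        using H by (simp add: nsets_def)
      then have "inj_on h H"
        using h by (meson bij_betw_imp_inj_on inj_on_subset)
      then obtain e where e: "e \<in> [H]\<^bsup>2\<^esup>" "e' = h ` e"
        using nset_image_obtains[OF e'] by blast
      then have "e \<in> [{..<N}]\<^bsup>2\<^esup>"
        using nsets_mono[OF HN] by blast
      then have "f (h ` e) \<in> C"
        using sub f by (auto simp: PiE_iff)
      moreover have "ix (f (h ` e)) = i"
        using mono e by auto
      ultimately show ?thesis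
        using ix[of "f (h ` e)"] e by simp
    qed
    then have "monochromatic V (b (cs ! i)) 2 f (cs ! i)"
      unfolding monochromatic_def using sub[OF H] i by (intro bexI[of _ "h ` H"]) auto
    moreover have "cs ! i \<in> C"
      using i cs by auto
    moreover have "switch_equivalent \<Delta> V f f"
      by (simp add: switch_equivalent_def)
    ultimately show "\<exists>g. switch_equivalent \<Delta> V f g \<and> (\<exists>c\<in>C. monochromatic V (b c) 2 g c)"
      by blast
  qed
  then show ?thesis
    unfolding switch_ramsey_def by (rule LeastI)
qed

lemma ramsey_number_attained: "partn_lst {..<ramsey_number bs} bs 2"
  unfolding ramsey_number_def using ramsey_full by (rule LeastI_ex)

text \<open>The orbits on \<open>{1..n}\<close> of a subgroup \<open>G\<close> of \<^term>\<open>sym_group n\<close>.\<close>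

definition perm_orbits :: "nat \<Rightarrow> (nat \<Rightarrow> nat) set \<Rightarrow> nat set set" where
  "perm_orbits n G = orbits ((sym_group n)\<lparr>carrier := G\<rparr>) {1..n} id"

text \<open>
  The permutations of the indices \<open>{1..k}\<close> that elements of \<open>G\<close> induce by permuting the sets
  \<open>B 1, \<dots>, B k\<close>. When the \<open>B i\<close> are the orbits of the commutator subgroup of \<open>G\<close>, that
  subgroup is normal and fixes each \<open>B i\<close>, so every element of \<open>G\<close> induces exactly one
  permutation, and it depends only on the class modulo the commutator subgroup.
\<close>

definition induced_perms :: "(nat \<Rightarrow> nat) set \<Rightarrow> nat \<Rightarrow> (nat \<Rightarrow> nat set) \<Rightarrow> (nat \<Rightarrow> nat) set" where
  "induced_perms G k B =
     {\<tau>. \<tau> permutes {1..k} \<and> (\<exists>\<sigma>\<in>G. \<forall>i\<in>{1..k}. \<sigma> ` B i = B (\<tau> i))}"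

end

theory Submission
  imports Defs
begin

text \<open>
  Switching at \<open>v\<close>, \<open>u\<close>, \<open>v\<close>, \<open>u\<close> with \<open>h\<^sub>2\<inverse>\<close>, \<open>h\<^sub>1\<inverse>\<close>, \<open>h\<^sub>2\<close>, \<open>h\<^sub>1\<close> applies the commutator of
  \<open>h\<^sub>1\<close> and \<open>h\<^sub>2\<close> to the colour of \<open>{u, v}\<close> and changes no other edge. Hence the colour of each
  edge matters only up to the orbits of \<open>[\<Gamma>, \<Gamma>]\<close>. Ramsey's theorem for the colours
  \<open>P\<^sub>1, \<dots>, P\<^sub>q\<close> yields \<open>m\<^sub>j\<close> vertices among which only orbits indexed by \<open>P\<^sub>j\<close> occur; the
  switches with \<open>\<Gamma>'\<close> that produce there a complete graph of \<open>n\<^sub>c\<close> vertices in one orbit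
  \<open>O\<^sub>c\<close> lift to \<open>\<Gamma>\<close>, and the edges of this graph can then be recoloured one by one with the colour
  in \<open>O\<^sub>c\<close> that attains \<open>n\<^sub>c\<close>.
\<close>

section \<open>Basic properties of switch equivalence\<close>

lemma switch_equivalent_trans:
  "switch_equivalent \<Delta> V f g \<Longrightarrow> switch_equivalent \<Delta> V g h \<Longrightarrow> switch_equivalent \<Delta> V f h"
  unfolding switch_equivalent_def by (rule rtranclp_trans)

lemma switch_equivalent_switch:
  assumes "v \<in> V" "\<pi> \<in> \<Delta>"
  shows "switch_equivalent \<Delta> V f (switch V v \<pi> f)"
  unfolding switch_equivalent_def using assms by (intro r_into_rtranclp) (auto simp: switch_step_def)

text \<open>\<open>switch\<close> returns \<open>undefined\<close> off the edges of
  \<open>V\<close>. Sequences of switches can therefore equal a pointwise update of \<open>f\<close>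
  only if \<open>f\<close> is extensional, an invariant carried through all later arguments.\<close>

lemma switch_extensional: "switch V v \<pi> f \<in> extensional ([V]\<^bsup>2\<^esup>)"
  by (simp add: switch_def)

lemma switch_equivalent_extensional:
  assumes "switch_equivalent \<Delta> V f g" "f \<in> extensional ([V]\<^bsup>2\<^esup>)"
  shows "g \<in> extensional ([V]\<^bsup>2\<^esup>)"
  using assms(1) unfolding switch_equivalent_def
proof (induction rule: rtranclp_induct)
  case base
  then show ?case by (fact assms(2))
next
  case (step g h)
  then show ?case by (auto simp: switch_step_def switch_extensional)
qed

section \<open>Subgroups of the symmetric group as sets of functions\<close>

lemma subgroup_sym_groupD:
  assumes "subgroup G (sym_group m)"
  shows "id \<in> G" and "\<And>\<sigma> \<tau>. \<sigma> \<in> G \<Longrightarrow> \<tau> \<in> G \<Longrightarrow> \<sigma> \<circ> \<tau> \<in> G"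
    and "\<And>\<sigma>. \<sigma> \<in> G \<Longrightarrow> inv' \<sigma> \<in> G" and "\<And>\<sigma>. \<sigma> \<in> G \<Longrightarrow> \<sigma> permutes {1..m}"
proof -
  show "id \<in> G"
    using subgroup.one_closed[OF assms] by (simp add: sym_group_one)
  show "\<sigma> \<circ> \<tau> \<in> G" if "\<sigma> \<in> G" "\<tau> \<in> G" for \<sigma> \<tau>
    using subgroup.m_closed[OF assms that] by (simp add: sym_group_mult)
  show p: "\<sigma> permutes {1..m}" if "\<sigma> \<in> G" for \<sigma>
    using subgroup.subset[OF assms] that by (auto simp: sym_group_carrier)
  show "inv' \<sigma> \<in> G" if "\<sigma> \<in> G" for \<sigma>
    using subgroup.m_inv_closed[OF assms that] p[OF that]
    by (simp add: sym_group_inv_equality sym_group_carrier)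
qed

section \<open>Recolouring single edges by the commutator subgroup\<close>

lemma switch_commutator:
  assumes G: "subgroup \<Gamma> (sym_group m)" and h: "h1 \<in> \<Gamma>" "h2 \<in> \<Gamma>"
    and uv: "u \<in> V" "v \<in> V" "u \<noteq> v" and f: "f \<in> extensional ([V]\<^bsup>2\<^esup>)"
  shows "switch_equivalent \<Gamma> V f
           (f({u, v} := (h1 \<circ> h2 \<circ> inv' h1 \<circ> inv' h2) (f {u, v})))"
proof -
  note GD = subgroup_sym_groupD[OF G]
  have inv: "h1 (inv' h1 x) = x" "h2 (inv' h2 x) = x" for x
    by (rule permutes_inverses(1)[OF GD(4)], rule h)+
  have uvV: "{u, v} \<in> [V]\<^bsup>2\<^esup>"
    using uv by (simp add: nsets_def)
  have only: "e = {u, v}" if e: "u \<in> e" "v \<in> e" "e \<in> [V]\<^bsup>2\<^esup>" for e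
  proof -
    obtain x y where "e = {x, y}"
      using e(3) by (rule nsets2_E)
    then show ?thesis
      using e(1,2) uv(3) by auto
  qed
  let ?f1 = "switch V v (inv' h2) f"
  let ?f2 = "switch V u (inv' h1) ?f1"
  let ?f3 = "switch V v h2 ?f2"
  let ?f4 = "switch V u h1 ?f3"
  have "?f4 = f({u, v} := (h1 \<circ> h2 \<circ> inv' h1 \<circ> inv' h2) (f {u, v}))"
  proof
    fix e
    show "?f4 e = (f({u, v} := (h1 \<circ> h2 \<circ> inv' h1 \<circ> inv' h2) (f {u, v}))) e"
    proof (cases "e \<in> [V]\<^bsup>2\<^esup>")
      case True
      \<comment> \<open>An edge meeting just one of \<open>u\<close>, \<open>v\<close> sees a
        permutation and its inverse, which cancel; only \<open>{u, v}\<close> sees all four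
        switches.\<close>
      consider "e = {u, v}" | "u \<in> e" "v \<notin> e" | "u \<notin> e" "v \<in> e" | "u \<notin> e" "v \<notin> e"
        using only[OF _ _ True] by blast
      then show ?thesis
        by cases (use True inv in \<open>auto simp: switch_def\<close>)
    next
      case False
      then have "f e = undefined" "e \<noteq> {u, v}"
        using f uvV by (auto simp: extensional_def)
      then show ?thesis
        using False by (simp add: switch_def)
    qed
  qed
  moreover have "switch_equivalent \<Gamma> V f ?f4"
    by (intro switch_equivalent_trans[OF switch_equivalent_switch switch_equivalent_trans[OF
          switch_equivalent_switch switch_equivalent_trans[OF
          switch_equivalent_switch switch_equivalent_switch]]] uv GD(3) h)
  ultimately show ?thesis by simp
qed

text \<open>The commutator subgroup is generated by commutators, so induction on generation reduces
  this to the single commutator.\<close>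

lemma switch_edge_derived:
  assumes G: "subgroup \<Gamma> (sym_group m)" and \<gamma>: "\<gamma> \<in> derived (sym_group m) \<Gamma>"
    and uv: "u \<in> V" "v \<in> V" "u \<noteq> v" and f: "f \<in> extensional ([V]\<^bsup>2\<^esup>)"
  shows "switch_equivalent \<Gamma> V f (f({u, v} := \<gamma> (f {u, v})))"
proof -
  interpret group "sym_group m"
    by (rule sym_group_is_group)
  note GD = subgroup_sym_groupD[OF G]
  have inv_eq: "inv\<^bsub>sym_group m\<^esub> \<sigma> = inv' \<sigma>" if "\<sigma> \<in> \<Gamma>" for \<sigma>
    using that GD(4) by (simp add: sym_group_inv_equality sym_group_carrier)
  have gen: "\<gamma> \<in> generate (sym_group m) (derived_set (sym_group m) \<Gamma>)"
    using \<gamma> by (simp add: derived_def)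
  then show ?thesis using f
  proof (induction arbitrary: f rule: generate.induct)
    case one
    then show ?case
      by (simp add: sym_group_one switch_equivalent_def)
  next
    case (incl h)
    then obtain h1 h2 where h: "h1 \<in> \<Gamma>" "h2 \<in> \<Gamma>" "h = h1 \<circ> h2 \<circ> inv' h1 \<circ> inv' h2"
      by (auto simp: inv_eq sym_group_mult)
    show ?case
      unfolding h(3) by (rule switch_commutator[OF G h(1,2) uv incl.prems])
  next
    case (inv h)
    then obtain h1 h2 where h: "h1 \<in> \<Gamma>" "h2 \<in> \<Gamma>" "h = h1 \<circ> h2 \<circ> inv' h1 \<circ> inv' h2"
      by (auto simp: inv_eq sym_group_mult)
    have b: "bij h1" "bij h2"
      using h GD(4) permutes_bij by blast+
    have "h \<in> \<Gamma>"
      unfolding h(3) by (intro GD(2) GD(3) h(1,2))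
    then have "inv\<^bsub>sym_group m\<^esub> h = inv' h"
      by (rule inv_eq)
    \<comment> \<open>The inverse of the commutator of \<open>h1\<close> and \<open>h2\<close> is
      the commutator of \<open>h2\<close> and \<open>h1\<close>.\<close>
    also have "\<dots> = h2 \<circ> h1 \<circ> inv' h2 \<circ> inv' h1"
      unfolding h(3) using b by (simp add: o_inv_distrib bij_comp bij_imp_bij_inv inv_inv_eq o_assoc)
    finally show ?case
      using switch_commutator[OF G h(2,1) uv inv.prems] by (simp only:)
  next
    \<comment> \<open>In the product \<open>h2\<close> acts first, so the hypothesis for
      \<open>h1\<close> is used on the colouring already changed by \<open>h2\<close>; this is why
      \<open>f\<close> is generalised in the induction.\<close>
    case (eng h1 h2)
    have 1: "switch_equivalent \<Gamma> V f (f({u, v} := h2 (f {u, v})))" (is "switch_equivalent _ _ _ ?g")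
      by (rule eng.IH(2)[OF eng.prems])
    then have "switch_equivalent \<Gamma> V ?g (?g({u, v} := h1 (?g {u, v})))"
      by (intro eng.IH(1) switch_equivalent_extensional[OF 1 eng.prems])
    then show ?case
      using switch_equivalent_trans[OF 1] by (simp add: sym_group_mult fun_upd_same del: fun_upd_apply)
  qed
qed

text \<open>Each edge may need its own element of the commutator subgroup. This is harmless, since
  recolouring one edge leaves all others alone.\<close>

lemma switch_edges_derived:
  assumes G: "subgroup \<Gamma> (sym_group m)" and f: "f \<in> extensional ([V]\<^bsup>2\<^esup>)"
    and E: "finite E" "E \<subseteq> [V]\<^bsup>2\<^esup>"
    and t: "\<And>e. e \<in> E \<Longrightarrow> \<exists>\<gamma>\<in>derived (sym_group m) \<Gamma>. t e = \<gamma> (f e)"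
  shows "switch_equivalent \<Gamma> V f (\<lambda>e. if e \<in> E then t e else f e)"
  using E t
proof (induction rule: finite_induct)
  case empty
  then show ?case
    by (simp add: switch_equivalent_def)
next
  case (insert e E)
  let ?g = "\<lambda>e. if e \<in> E then t e else f e"
  have fg: "switch_equivalent \<Gamma> V f ?g"
    using insert by auto
  obtain u v where e: "e = {u, v}" "u \<in> V" "v \<in> V" "u \<noteq> v"
    using insert.prems(1) by (auto simp: nsets_2_eq)
  obtain \<gamma> where \<gamma>: "\<gamma> \<in> derived (sym_group m) \<Gamma>" "t e = \<gamma> (f e)"
    using insert.prems(2) by blast
  have "switch_equivalent \<Gamma> V ?g (?g({u, v} := \<gamma> (?g {u, v})))"
    by (rule switch_edge_derived[OF G \<gamma>(1) e(2-4) switch_equivalent_extensional[OF fg f]])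
  \<comment> \<open>As \<open>e\<close> is not in \<open>E\<close>, it still has its original colour
    \<open>f e\<close>, to which \<open>\<gamma>\<close> refers.\<close>
  moreover have "?g({u, v} := \<gamma> (?g {u, v})) = (\<lambda>e'. if e' \<in> insert e E then t e' else f e')"
    using \<gamma>(2) insert.hyps(2) by (auto simp: e(1))
  ultimately show ?case
    using switch_equivalent_trans[OF fg] by simp
qed

section \<open>Lifting switches from orbit indices to colours\<close>

text \<open>A simulation argument: each switch on \<open>H\<close> with an element of
  \<open>\<Delta>\<close> is imitated by a switch on \<open>V\<close> at the same vertex with a
  matching element of \<open>\<Gamma>\<close>. Edges of \<open>V\<close> outside \<open>H\<close>
  may change too, but \<open>R\<close> constrains only those inside \<open>H\<close>.\<close>

lemma switch_equivalent_lift: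
  assumes HV: "H \<subseteq> V"
    and lift: "\<And>\<tau>. \<tau> \<in> \<Delta> \<Longrightarrow> \<exists>\<sigma>\<in>\<Gamma>. \<forall>x y. R x y \<longrightarrow> R (\<sigma> x) (\<tau> y)"
    and eq: "switch_equivalent \<Delta> H f' g'"
    and R: "\<And>e. e \<in> [H]\<^bsup>2\<^esup> \<Longrightarrow> R (f e) (f' e)"
  obtains g where "switch_equivalent \<Gamma> V f g" "\<And>e. e \<in> [H]\<^bsup>2\<^esup> \<Longrightarrow> R (g e) (g' e)"
proof -
  have "\<exists>g. switch_equivalent \<Gamma> V f g \<and> (\<forall>e\<in>[H]\<^bsup>2\<^esup>. R (g e) (g' e))"
    using eq unfolding switch_equivalent_def[of \<Delta>]
  proof (induction rule: rtranclp_induct)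
    case base
    show ?case
      using R by (intro exI[of _ f]) (simp add: switch_equivalent_def)
  next
    case (step g' h')
    then obtain g where g: "switch_equivalent \<Gamma> V f g" "\<forall>e\<in>[H]\<^bsup>2\<^esup>. R (g e) (g' e)"
      by blast
    obtain v \<tau> where v: "v \<in> H" "\<tau> \<in> \<Delta>" "h' = switch H v \<tau> g'"
      using step.hyps(2) by (auto simp: switch_step_def)
    obtain \<sigma> where \<sigma>: "\<sigma> \<in> \<Gamma>" "\<forall>x y. R x y \<longrightarrow> R (\<sigma> x) (\<tau> y)"
      using lift[OF v(2)] by blast
    have "switch_equivalent \<Gamma> V f (switch V v \<sigma> g)"
      using v(1) HV \<sigma>(1) by (intro switch_equivalent_trans[OF g(1)] switch_equivalent_switch) auto
    moreover have "\<forall>e\<in>[H]\<^bsup>2\<^esup>. R (switch V v \<sigma> g e) (h' e)"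
      using g(2) \<sigma>(2) nsets_mono[OF HV, of 2] by (auto simp: switch_def v(3))
    ultimately show ?case by blast
  qed
  then show ?thesis
    using that by blast
qed

section \<open>Transport of the Ramsey property to any vertex set of the same size\<close>

lemma partn_lst_card_eq:
  fixes V :: "'a set"
  assumes part: "partn_lst {..<N} bs r" and V: "finite V" "card V = N"
  shows "partn_lst V bs r"
proof -
  obtain h where h: "bij_betw h {..<N} V"
    by (metis V card_lessThan finite_lessThan finite_same_card_bij)
  have sub: "h ` e \<in> [V]\<^bsup>k\<^esup>" if "e \<in> [{..<N}]\<^bsup>k\<^esup>" for e k
    using bij_betw_nsets[OF h] that by (auto simp: bij_betw_def)
  show ?thesis
    unfolding partn_lst_def
  proof
    fix f :: "'a set \<Rightarrow> nat" assume "f \<in> [V]\<^bsup>r\<^esup> \<rightarrow> {..<length bs}"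
    then have "(\<lambda>e. f (h ` e)) \<in> [{..<N}]\<^bsup>r\<^esup> \<rightarrow> {..<length bs}"
      using sub by (auto simp: Pi_iff)
    then obtain i H where i: "i < length bs" and H: "H \<in> [{..<N}]\<^bsup>(bs ! i)\<^esup>"
      and mono: "(\<lambda>e. f (h ` e)) ` [H]\<^bsup>r\<^esup> \<subseteq> {i}"
      using part unfolding partn_lst_def monochromatic_def by blast
    have "H \<subseteq> {..<N}"
      using H by (simp add: nsets_def)
    then have "inj_on h H"
      using h by (meson bij_betw_imp_inj_on inj_on_subset)
    have "f ` [h ` H]\<^bsup>r\<^esup> \<subseteq> {i}"
    proof (rule image_subsetI)
      fix e' assume "e' \<in> [h ` H]\<^bsup>r\<^esup>"
      then obtain e where "e \<in> [H]\<^bsup>r\<^esup>" "e' = h ` e"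
        using \<open>inj_on h H\<close> by (rule nset_image_obtains)
      then show "f e' \<in> {i}"
        using mono by blast
    qed
    then show "\<exists>i<length bs. monochromatic V (bs ! i) r f i"
      using i sub[OF H] by (auto simp: monochromatic_def)
  qed
qed

section \<open>Orbits and induced permutations\<close>

lemma in_perm_orbits:
  assumes "id \<in> G" "x \<in> {1..m}"
  obtains B where "B \<in> perm_orbits m G" "x \<in> B"
proof -
  have "Group_Action.orbit ((sym_group m)\<lparr>carrier := G\<rparr>) id x \<in> perm_orbits m G"
    using assms(2) by (auto simp: perm_orbits_def orbits_def)
  moreover have "x \<in> Group_Action.orbit ((sym_group m)\<lparr>carrier := G\<rparr>) id x"
    using assms(1) by (auto simp: Group_Action.orbit_def intro!: exI[of _ id])
  ultimately show ?thesis by (rule that)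
qed

lemma perm_orbitsE:
  assumes "B \<in> perm_orbits m G"
  obtains x where "x \<in> {1..m}" "B = (\<lambda>g. g x) ` G"
proof -
  obtain x where x: "x \<in> {1..m}" "B = Group_Action.orbit ((sym_group m)\<lparr>carrier := G\<rparr>) id x"
    using assms unfolding perm_orbits_def orbits_def by blast
  then show ?thesis
    by (intro that[of x]) (auto simp: Group_Action.orbit_def)
qed

lemma id_in_induced_perms: "id \<in> G \<Longrightarrow> id \<in> induced_perms G k B"
  by (auto simp: induced_perms_def permutes_id intro!: bexI[of _ id])

text \<open>Composing the inducing elements of \<open>G\<close> induces the composite. It serves to
  show that each orbit of \<open>\<Gamma>'\<close> is mapped into itself by
  \<open>\<Gamma>'\<close>.\<close>

lemma comp_in_induced_perms:
  assumes "\<And>\<sigma> \<sigma>'. \<sigma> \<in> G \<Longrightarrow> \<sigma>' \<in> G \<Longrightarrow> \<sigma> \<circ> \<sigma>' \<in> G"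
    and "\<tau> \<in> induced_perms G k B" "\<tau>' \<in> induced_perms G k B"
  shows "\<tau> \<circ> \<tau>' \<in> induced_perms G k B"
proof -
  obtain \<sigma> \<sigma>' where \<sigma>: "\<sigma> \<in> G" "\<forall>i\<in>{1..k}. \<sigma> ` B i = B (\<tau> i)"
    "\<sigma>' \<in> G" "\<forall>i\<in>{1..k}. \<sigma>' ` B i = B (\<tau>' i)"
    and \<tau>: "\<tau> permutes {1..k}" "\<tau>' permutes {1..k}"
    using assms(2,3) by (auto simp: induced_perms_def)
  have "(\<sigma> \<circ> \<sigma>') ` B i = B ((\<tau> \<circ> \<tau>') i)" if "i \<in> {1..k}" for i
  proof -
    have "\<tau>' i \<in> {1..k}"
      by (subst permutes_in_image[OF \<tau>(2)]) (rule that)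
    then show ?thesis
      by (simp only: image_comp[symmetric] bspec[OF \<sigma>(4) that] bspec[OF \<sigma>(2)] comp_apply)
  qed
  then have "\<forall>i\<in>{1..k}. (\<sigma> \<circ> \<sigma>') ` B i = B ((\<tau> \<circ> \<tau>') i)"
    by (rule ballI)
  then show ?thesis
    unfolding induced_perms_def mem_Collect_eq
    using assms(1)[OF \<sigma>(1,3)] permutes_compose[OF \<tau>(2,1)] by (intro conjI bexI)
qed

theorem theorem12:
  fixes m k q :: nat
    and \<Gamma> \<Gamma>' :: "(nat \<Rightarrow> nat) set"
    and a n M :: "nat \<Rightarrow> nat"
    and Orb P :: "nat \<Rightarrow> nat set"
  assumes "subgroup \<Gamma> (sym_group m)"
    and "\<And>j. j \<in> {1..m} \<Longrightarrow> a j \<ge> 2"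
    and "bij_betw Orb {1..k} (perm_orbits m (derived (sym_group m) \<Gamma>))"
    and "\<And>i. i \<in> {1..k} \<Longrightarrow> n i = Min (a ` Orb i)"
    and "\<Gamma>' = induced_perms \<Gamma> k Orb"
    and "bij_betw P {1..q} (perm_orbits k \<Gamma>')"
    and "\<And>j. j \<in> {1..q} \<Longrightarrow>
           M j = switch_ramsey ((\<lambda>\<tau>. perm_restrict \<tau> (P j)) ` \<Gamma>') (P j) n"
  shows "switch_ramsey \<Gamma> {1..m} a \<le> ramsey_number (map M [1..<Suc q])"
proof -

  \<comment> \<open>The orbits \<open>Orb i\<close> of the commutator subgroup and the orbits
    \<open>P j\<close> of \<open>\<Gamma>'\<close>\<close>
  let ?D = "derived (sym_group m) \<Gamma>"
  note GD = subgroup_sym_groupD[OF assms(1)]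
  have "subgroup ?D (sym_group m)"
    by (intro group.derived_is_subgroup sym_group_is_group subgroup.subset assms(1))
  note DD = subgroup_sym_groupD[OF this]
  have OrbE: "\<exists>x\<in>{1..m}. Orb i = (\<lambda>g. g x) ` ?D" if "i \<in> {1..k}" for i
    by (rule perm_orbitsE[OF bij_betw_apply[OF assms(3) that]]) blast
  have Orb_sub: "Orb i \<subseteq> {1..m}" and Orb_ne: "Orb i \<noteq> {}" if i: "i \<in> {1..k}" for i
  proof -
    obtain z where z: "z \<in> {1..m}" "Orb i = (\<lambda>g. g z) ` ?D"
      using OrbE[OF i] by blast
    show "Orb i \<noteq> {}"
      using z(2) DD(1) by blast
    show "Orb i \<subseteq> {1..m}"
      unfolding z(2) using permutes_in_image[OF DD(4)] z(1) by (intro image_subsetI) simp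
  qed
  have Orb_trans: "\<exists>\<gamma>\<in>?D. y = \<gamma> x" if i: "i \<in> {1..k}" and xy: "x \<in> Orb i" "y \<in> Orb i" for i x y
  proof -
    obtain z \<gamma> \<gamma>' where \<gamma>: "\<gamma> \<in> ?D" "\<gamma>' \<in> ?D" "x = \<gamma> z" "y = \<gamma>' z"
      using OrbE[OF i] xy by auto
    \<comment> \<open>Pass from \<open>x\<close> back to the base point \<open>z\<close> of the
      orbit and on to \<open>y\<close>.\<close>
    then have "y = (\<gamma>' \<circ> inv' \<gamma>) x"
      using permutes_inverses(2)[OF DD(4)[OF \<gamma>(1)]] by simp
    then show ?thesis
      using DD(2)[OF \<gamma>(2) DD(3)[OF \<gamma>(1)]] by blast
  qed
  have Orb_cover: "\<exists>i\<in>{1..k}. x \<in> Orb i" if "x \<in> {1..m}" for x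
    by (rule in_perm_orbits[OF DD(1) that]) (use bij_betw_imp_surj_on[OF assms(3)] in blast)
  have \<Gamma>'_perm: "\<tau> permutes {1..k}" if "\<tau> \<in> \<Gamma>'" for \<tau>
    using that by (simp add: assms(5) induced_perms_def)
  have PE: "\<exists>x\<in>{1..k}. P j = (\<lambda>g. g x) ` \<Gamma>'" if "j \<in> {1..q}" for j
    by (rule perm_orbitsE[OF bij_betw_apply[OF assms(6) that]]) blast
  have P_sub: "P j \<subseteq> {1..k}" if j: "j \<in> {1..q}" for j
  proof -
    obtain z where z: "z \<in> {1..k}" "P j = (\<lambda>g. g z) ` \<Gamma>'"
      using PE[OF j] by blast
    show ?thesis
      unfolding z(2) using permutes_in_image[OF \<Gamma>'_perm] z(1) by (intro image_subsetI) simp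
  qed
  have P_closed: "\<tau> i \<in> P j" if "j \<in> {1..q}" "\<tau> \<in> \<Gamma>'" "i \<in> P j" for i j \<tau>
  proof -
    obtain x \<tau>' where x: "P j = (\<lambda>g. g x) ` \<Gamma>'" "\<tau>' \<in> \<Gamma>'" "i = \<tau>' x"
      using PE[OF \<open>j \<in> {1..q}\<close>] \<open>i \<in> P j\<close> by auto
    have "\<tau> \<circ> \<tau>' \<in> \<Gamma>'"
      using comp_in_induced_perms[OF GD(2)] that(2) x(2) unfolding assms(5) by blast
    then show ?thesis
      unfolding x(1) by (rule rev_image_eqI) (simp add: x(3))
  qed
  have "id \<in> \<Gamma>'"
    by (simp add: assms(5) id_in_induced_perms GD(1))
  then have P_cover: "\<exists>j\<in>{1..q}. i \<in> P j" if "i \<in> {1..k}" for i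
    by (rule in_perm_orbits[OF _ that]) (use bij_betw_imp_surj_on[OF assms(6)] in blast)

  \<comment> \<open>The Ramsey argument on \<open>V\<close>\<close>
  let ?bs = "map M [1..<Suc q]"
  have "switch_arrows \<Gamma> {1..m} a (ramsey_number ?bs)"
    unfolding switch_arrows_def
  proof (intro allI impI ballI)
    fix V :: "nat set" and f
    assume V: "finite V \<and> card V = ramsey_number ?bs" and f: "f \<in> [V]\<^bsup>2\<^esup> \<rightarrow>\<^sub>E {1..m}"
    \<comment> \<open>\<open>ob\<close> sends a colour to the index of its orbit, and
      \<open>pa\<close> sends such an index to the number of its class among the
      \<open>P j\<close>.\<close>
    obtain ob where ob: "ob x \<in> {1..k}" "x \<in> Orb (ob x)" if "x \<in> {1..m}" for x
      using Orb_cover by metis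
    obtain pa where pa: "pa i \<in> {1..q}" "i \<in> P (pa i)" if "i \<in> {1..k}" for i
      using P_cover by metis
    have fV: "f e \<in> {1..m}" if "e \<in> [V]\<^bsup>2\<^esup>" for e
      using f that by auto
    have "partn_lst V ?bs 2"
      using partn_lst_card_eq ramsey_number_attained V by blast
    \<comment> \<open>\<open>partn_lst\<close> numbers colours from 0, the classes
      \<open>P j\<close> from 1. Nothing is lost by subtracting, as \<open>pa\<close> is at least 1
      here, and entry \<open>i\<close> of the list is \<open>M (Suc i)\<close>.\<close>
    moreover have "(\<lambda>e. pa (ob (f e)) - 1) \<in> [V]\<^bsup>2\<^esup> \<rightarrow> {..<length ?bs}"
      using pa(1)[OF ob(1)[OF fV]] by fastforce
    ultimately obtain i H where i: "i < length ?bs" and H: "H \<in> [V]\<^bsup>(?bs ! i)\<^esup>"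
      and mono: "(\<lambda>e. pa (ob (f e)) - 1) ` [H]\<^bsup>2\<^esup> \<subseteq> {i}"
      unfolding partn_lst_def monochromatic_def by meson
    define j where "j = Suc i"
    have j: "j \<in> {1..q}"
      using i by (simp add: j_def del: upt_Suc)
    have HV: "H \<subseteq> V" and finH: "finite H" and cardH: "card H = M j"
      using H i by (auto simp: nsets_def j_def simp del: upt_Suc)
    have HV2: "e \<in> [V]\<^bsup>2\<^esup>" if "e \<in> [H]\<^bsup>2\<^esup>" for e
      using that nsets_mono[OF HV] by blast
    have obP: "ob (f e) \<in> P j" if e: "e \<in> [H]\<^bsup>2\<^esup>" for e
    proof -
      have "pa (ob (f e)) - 1 = i"
        using mono e by auto
      then have "pa (ob (f e)) = j"
        using pa(1)[OF ob(1)[OF fV[OF HV2[OF e]]]] by (auto simp: j_def)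
      then show ?thesis
        using pa(2)[OF ob(1)[OF fV[OF HV2[OF e]]]] by simp
    qed
    let ?\<Delta> = "(\<lambda>\<tau>. perm_restrict \<tau> (P j)) ` \<Gamma>'"
    \<comment> \<open>Inside \<open>H\<close> edges are coloured by orbit indices, all in
      \<open>P j\<close>. As \<open>H\<close> has \<open>M j\<close> vertices, the definition of
      \<open>M j\<close> applies to this colouring.\<close>
    define f' where "f' = (\<lambda>e\<in>[H]\<^bsup>2\<^esup>. ob (f e))"
    have "f' \<in> [H]\<^bsup>2\<^esup> \<rightarrow>\<^sub>E P j"
      using obP by (simp add: f'_def)
    moreover have "switch_arrows ?\<Delta> (P j) n (M j)"
      using switch_ramsey_attained[OF finite_subset[OF P_sub[OF j]]] assms(7)[OF j] by simp
    ultimately obtain g' c where g': "switch_equivalent ?\<Delta> H f' g'"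
      and c: "c \<in> P j" and mono_g': "monochromatic H (n c) 2 g' c"
      using finH cardH unfolding switch_arrows_def by metis
    \<comment> \<open>The simulation relation: the colour \<open>x\<close> lies in the orbit with
      index \<open>y\<close>. Requiring \<open>y\<close> in \<open>P j\<close> makes the restricted
      permutation agree with \<open>\<tau>'\<close> at \<open>y\<close> and puts \<open>y\<close> in
      the range where \<open>\<sigma>\<close> is known to permute the orbits.\<close>
    let ?R = "\<lambda>x y. y \<in> P j \<and> x \<in> Orb y"
    have lift: "\<exists>\<sigma>\<in>\<Gamma>. \<forall>x y. ?R x y \<longrightarrow> ?R (\<sigma> x) (\<tau> y)" if \<tau>: "\<tau> \<in> ?\<Delta>" for \<tau>
    proof -
      obtain \<tau>' where \<tau>': "\<tau>' \<in> \<Gamma>'" "\<tau> = perm_restrict \<tau>' (P j)"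
        using \<tau> by (rule imageE)
      obtain \<sigma> where \<sigma>: "\<sigma> \<in> \<Gamma>" "\<forall>i\<in>{1..k}. \<sigma> ` Orb i = Orb (\<tau>' i)"
        using \<tau>'(1) by (auto simp: assms(5) induced_perms_def)
      have "?R (\<sigma> x) (\<tau> y)" if "?R x y" for x y
        using that P_closed[OF j \<tau>'(1)] \<sigma>(2) P_sub[OF j] by (auto simp: \<tau>'(2) perm_restrict_def)
      then show ?thesis
        using \<sigma>(1) by blast
    qed
    have Rf: "?R (f e) (f' e)" if "e \<in> [H]\<^bsup>2\<^esup>" for e
      using obP[OF that] ob(2)[OF fV[OF HV2[OF that]]] that by (simp add: f'_def)
    obtain g where g: "switch_equivalent \<Gamma> V f g"
      and Rg: "\<And>e. e \<in> [H]\<^bsup>2\<^esup> \<Longrightarrow> ?R (g e) (g' e)"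
      using switch_equivalent_lift[of H V ?\<Delta> \<Gamma> ?R f' g' f] HV lift g' Rf by blast
    obtain K where K: "K \<subseteq> H" "finite K" "card K = n c" and g'K: "\<And>e. e \<in> [K]\<^bsup>2\<^esup> \<Longrightarrow> g' e = c"
      using mono_g' by (auto simp: monochromatic_def nsets_def image_subset_iff)
    have ck: "c \<in> {1..k}"
      using P_sub[OF j] c by blast
    have "finite (Orb c)"
      using Orb_sub[OF ck] finite_subset by blast
    \<comment> \<open>A minimum over a finite nonempty orbit is attained; this yields the colour
      \<open>x\<close> for the final clique.\<close>
    then have "n c \<in> a ` Orb c"
      unfolding assms(4)[OF ck] using Orb_ne[OF ck] by (intro Min_in) auto
    then obtain x where x: "x \<in> Orb c" "a x = n c"
      by auto
    have gK: "g e \<in> Orb c" if "e \<in> [K]\<^bsup>2\<^esup>" for e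
      using Rg[of e] g'K[OF that] that nsets_mono[OF K(1)] by fastforce
    \<comment> \<open>On \<open>K\<close> every colour of \<open>g\<close> lies in the orbit of
      \<open>x\<close>, so all edges of \<open>K\<close> can be given colour \<open>x\<close>. Its
      \<open>n c = a x\<close> vertices are exactly what \<open>x\<close> demands.\<close>
    let ?g = "\<lambda>e. if e \<in> [K]\<^bsup>2\<^esup> then x else g e"
    have "switch_equivalent \<Gamma> V g ?g"
    proof (rule switch_edges_derived[OF assms(1)])
      show "g \<in> extensional ([V]\<^bsup>2\<^esup>)"
        using switch_equivalent_extensional[OF g] f by (auto simp: PiE_iff)
      show "finite ([K]\<^bsup>2\<^esup>)"
        using K(2) by (simp add: finite_imp_finite_nsets)
      show "[K]\<^bsup>2\<^esup> \<subseteq> [V]\<^bsup>2\<^esup>"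
        using K(1) HV by (intro nsets_mono) auto
      show "\<exists>\<gamma>\<in>?D. x = \<gamma> (g e)" if "e \<in> [K]\<^bsup>2\<^esup>" for e
        using Orb_trans[OF ck gK[OF that] x(1)] .
    qed
    then have "switch_equivalent \<Gamma> V f ?g"
      by (rule switch_equivalent_trans[OF g])
    moreover have "monochromatic V (a x) 2 ?g x"
      using K HV x(2) by (auto simp: monochromatic_def nsets_def intro!: exI[of _ K])
    moreover have "x \<in> {1..m}"
      using Orb_sub[OF ck] x(1) by blast
    ultimately show "\<exists>g. switch_equivalent \<Gamma> V f g \<and> (\<exists>c\<in>{1..m}. monochromatic V (a c) 2 g c)"
      by blast
  qed
  then show ?thesis
    unfolding switch_ramsey_def by (rule Least_le)
qed

end
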